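(* Let $k$ be a field, let $\Delta$ be a simplicial complex with facets $A_1,\dots,A_r$, and fix an integer $m$. The following are equivalent: (1) $\tilde H_{i-1}(N_{j+1}(\Delta);k)=0$ for all integers $i,j\ge 0$ with $i+j<m$; (2) $\tilde H_{i-1}(\operatorname{lk}_\Delta(T);k)=0$ for all integers $i,j\ge 0$ with $i+j<m$ and all faces $T\in\Delta$ with $|T|=j$.
   Context: $N_{j}(\Delta)=\{F\subseteq[r] : |\bigcap_{l\in F}A_l|\ge j\}$ is the $j$-th nerve complex of $\Delta$ (the empty set is always a face). For $T\in\Delta$, $\operatorname{lk}_\Delta(T)=\{G\in\Delta : G\cup T\in\Delta,\ G\cap T=\varnothing\}$ is the link of $T$ (so $\operatorname{lk}_\Delta(\varnothing)=\Delta$ and $\operatorname{lk}_\Delta(T)=\{\varnothing\}$ if $T$ is a facet). $\tilde H$ is reduced simplicial homology with coefficients in $k$, with $\tilde H_{-1}(\{\varnothing\})=k$. *)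

theory Defs
  imports "HOL-Algebra.Elementary_Groups" "HOL-Library.Poly_Mapping"
begin

definition simplicial_complex :: "'v set set \<Rightarrow> bool" where
  "simplicial_complex \<Delta> \<longleftrightarrow>
     {} \<in> \<Delta> \<and> (\<forall>F\<in>\<Delta>. finite F) \<and> (\<forall>F\<in>\<Delta>. \<forall>G. G \<subseteq> F \<longrightarrow> G \<in> \<Delta>)"

definition facets :: "'v set set \<Rightarrow> 'v set set" where
  "facets \<Delta> = {F \<in> \<Delta>. \<forall>G\<in>\<Delta>. F \<subseteq> G \<longrightarrow> G = F}"

definition link :: "'v set set \<Rightarrow> 'v set \<Rightarrow> 'v set set" where
  "link \<Delta> T = {G \<in> \<Delta>. G \<union> T \<in> \<Delta> \<and> G \<inter> T = {}}"

text \<open>The \<open>j\<close>-th nerve complex of the complex with facets \<open>A 1, \<dots>, A r\<close>. The empty face is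
  listed separately because the intersection over the empty family is \<open>UNIV\<close>, whose \<open>card\<close>
  is \<open>0\<close> when the type of vertices is infinite.\<close>

definition nerve_complex :: "nat \<Rightarrow> (nat \<Rightarrow> 'v set) \<Rightarrow> nat \<Rightarrow> nat set set" where
  "nerve_complex r A j = {F. F \<subseteq> {1..r} \<and> (F = {} \<or> card (\<Inter>l\<in>F. A l) \<ge> j)}"

text \<open>Augmented simplicial chains with coefficients in a field: finitely supported functions on
  faces, with every face oriented by the linear order of the vertices. The degree \<open>q\<close> is an
  integer, and the empty face spans degree \<open>-1\<close>.\<close>

definition simplicial_chains :: "int \<Rightarrow> 'v set set \<Rightarrow> ('v set \<Rightarrow>\<^sub>0 'k::field) set" where
  "simplicial_chains q \<Delta> = {c. Poly_Mapping.keys c \<subseteq> {F \<in> \<Delta>. int (card F) = q + 1}}"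

text \<open>For \<open>F = {v\<^sub>0 < \<dots> < v\<^sub>q}\<close>, the face \<open>F - {v\<^sub>i}\<close> has coefficient \<open>(-1) ^ i\<close>, and
  \<open>i\<close> is the number of vertices of \<open>F\<close> below \<open>v\<^sub>i\<close>. In degree \<open>0\<close> this is the augmentation.\<close>

definition boundary :: "('v::linorder set \<Rightarrow>\<^sub>0 'k::field) \<Rightarrow> ('v set \<Rightarrow>\<^sub>0 'k)" where
  "boundary c = (\<Sum>F\<in>Poly_Mapping.keys c. \<Sum>v\<in>F.
     Poly_Mapping.single (F - {v}) ((- 1) ^ card {u \<in> F. u < v} * Poly_Mapping.lookup c F))"

definition cycles :: "int \<Rightarrow> 'v::linorder set set \<Rightarrow> ('v set \<Rightarrow>\<^sub>0 'k::field) set" where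
  "cycles q \<Delta> = {c \<in> simplicial_chains q \<Delta>. boundary c = 0}"

definition boundaries :: "int \<Rightarrow> 'v::linorder set set \<Rightarrow> ('v set \<Rightarrow>\<^sub>0 'k::field) set" where
  "boundaries q \<Delta> = boundary ` simplicial_chains (q + 1) \<Delta>"

definition cycle_group :: "int \<Rightarrow> 'v::linorder set set \<Rightarrow> ('v set \<Rightarrow>\<^sub>0 'k::field) monoid" where
  "cycle_group q \<Delta> = \<lparr>carrier = cycles q \<Delta>, monoid.mult = (+), one = 0\<rparr>"

text \<open>The reduced homology in degree \<open>q\<close> with coefficients in the field \<open>'k\<close>, as an additive
  group. This is enough to express that the vector space is \<open>0\<close>.\<close>

definition reduced_homology ::
    "'k::field itself \<Rightarrow> int \<Rightarrow> 'v::linorder set set \<Rightarrow> ('v set \<Rightarrow>\<^sub>0 'k) set monoid" where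
  "reduced_homology k q \<Delta> = cycle_group q \<Delta> Mod boundaries q \<Delta>"

end

theory Submission
  imports Defs "HOL-Library.Product_Lexorder" HOL.Modules
begin

text \<open>The nerves form a decreasing filtration that starts with the full simplex \<open>N\<^sub>0\<close>. A face \<open>F\<close> lies in
  \<open>N\<^sub>j\<close> but not in \<open>N\<^sub>j\<^sub>+\<^sub>1\<close> iff \<open>T = (\<Inter>l\<in>F. A l)\<close> has \<open>j\<close> elements, and passing to a proper subset
  of \<open>F\<close> either keeps \<open>T\<close> or leads into \<open>N\<^sub>j\<^sub>+\<^sub>1\<close>. So the relative chain complex of
  \<open>(N\<^sub>j, N\<^sub>j\<^sub>+\<^sub>1)\<close> is the direct sum over the faces \<open>T\<close> of size \<open>j\<close> of the relative complexes of a full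
  simplex on \<open>{l. T \<subseteq> A l}\<close> modulo its faces with \<open>(\<Inter>l\<in>F. A l) \<noteq> T\<close>. The latter form the nerve of
  the cover of the link of \<open>T\<close> by the sets \<open>A l - T\<close>, so by the nerve lemma there is a long exact
  sequence
  \<open>H\<^sub>i(N\<^sub>j) \<rightarrow> \<Oplus>\<^sub>T H\<^sub>i\<^sub>-\<^sub>1(lk T) \<rightarrow> H\<^sub>i\<^sub>-\<^sub>1(N\<^sub>j\<^sub>+\<^sub>1) \<rightarrow> H\<^sub>i\<^sub>-\<^sub>1(N\<^sub>j)\<close>,
  from which both implications are read off.\<close>

subsection \<open>Chains\<close>

lemma poly_mapping_eq_sum_single:
  "c = (\<Sum>F\<in>Poly_Mapping.keys c. Poly_Mapping.single F (Poly_Mapping.lookup c F))"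
  by (rule poly_mapping_eqI) (auto simp: lookup_sum lookup_single when_def in_keys_iff)

text \<open>Decomposing \<open>c\<close> into singles reduces a chain identity to one face. Only
  faces in the support of \<open>c\<close> are tested, so that finiteness or monotonicity on these
  faces may be assumed.\<close>

lemma additive_eq_on_singles:
  assumes "Modules.additive f" "Modules.additive g"
    and "\<And>F a. F \<in> Poly_Mapping.keys c \<Longrightarrow> f (Poly_Mapping.single F a) = g (Poly_Mapping.single F a)"
  shows "f c = g c"
proof -
  interpret f: Modules.additive f by fact
  interpret g: Modules.additive g by fact
  show ?thesis
    by (subst (1 2) poly_mapping_eq_sum_single) (simp add: f.sum g.sum assms(3))
qed

text \<open>The additive extension from single faces. \<open>boundary\<close>, \<open>cone\<close>
  and \<open>chain_image\<close> all have this form, so additivity is proved once for the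
  three.\<close>

definition chain_lift :: "('a \<Rightarrow> 'k::ab_group_add \<Rightarrow> 'c::ab_group_add) \<Rightarrow> ('a \<Rightarrow>\<^sub>0 'k) \<Rightarrow> 'c" where
  "chain_lift f c = (\<Sum>F\<in>Poly_Mapping.keys c. f F (Poly_Mapping.lookup c F))"

lemma additive_chain_lift:
  assumes "\<And>F. Modules.additive (f F)"
  shows "Modules.additive (chain_lift f)"
proof
  fix c d
  \<comment> \<open>Cancellation can make the support of \<open>c + d\<close> smaller than the union
    of the two supports, so all three sums are extended to that union.\<close>
  have superset: "chain_lift f c = (\<Sum>F\<in>S. f F (Poly_Mapping.lookup c F))"
    if "finite S" "Poly_Mapping.keys c \<subseteq> S" for c S
    unfolding chain_lift_def
    by (rule sum.mono_neutral_left)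
      (use that Modules.additive.zero[OF assms] in \<open>auto simp: in_keys_iff\<close>)
  show "chain_lift f (c + d) = chain_lift f c + chain_lift f d"
    using superset[of "Poly_Mapping.keys c \<union> Poly_Mapping.keys d"] keys_add[of c d]
    by (simp add: lookup_add Modules.additive.add[OF assms] sum.distrib)
qed

lemma chain_lift_single:
  "Modules.additive (f F) \<Longrightarrow> chain_lift f (Poly_Mapping.single F a) = f F a"
  by (simp add: chain_lift_def Modules.additive.zero)

section \<open>The boundary, exterior multiplication and their signs\<close>

text \<open>For \<open>v \<in> F\<close> this is the sign with which \<open>boundary\<close> deletes
  \<open>v\<close>; for \<open>v \<notin> F\<close> it is the sign of moving \<open>v\<close> from
  the front to its sorted place in \<open>insert v F\<close>.\<close>

definition vertex_sign :: "'v::linorder \<Rightarrow> 'v set \<Rightarrow> 'k::field" where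
  "vertex_sign v F = (- 1) ^ card {u \<in> F. u < v}"

lemma vertex_sign_square: "vertex_sign v F * (vertex_sign v F * a) = (a::'k::field)"
  by (simp add: vertex_sign_def flip: mult.assoc power_mult_distrib)

lemma additive_signed_single_sum:
  "Modules.additive (\<lambda>a. \<Sum>v\<in>F. Poly_Mapping.single (h v) (vertex_sign v F * a))"
  by standard (simp add: distrib_left single_add sum.distrib)

lemma boundary_eq_chain_lift:
  "boundary = chain_lift (\<lambda>F a. \<Sum>v\<in>F. Poly_Mapping.single (F - {v}) (vertex_sign v F * a))"
  by (simp add: fun_eq_iff boundary_def chain_lift_def vertex_sign_def)

interpretation boundary: Modules.additive boundary
  unfolding boundary_eq_chain_lift
  by (rule additive_chain_lift) (rule additive_signed_single_sum)

lemma boundary_single: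
  "boundary (Poly_Mapping.single F a) =
     (\<Sum>v\<in>F. Poly_Mapping.single (F - {v}) (vertex_sign v F * a))"
  unfolding boundary_eq_chain_lift
  by (rule chain_lift_single) (rule additive_signed_single_sum)

lemma keys_boundary:
  assumes "F \<in> Poly_Mapping.keys (boundary c)"
  obtains G v where "G \<in> Poly_Mapping.keys c" "v \<in> G" "F = G - {v}"
  using assms unfolding boundary_def
  by (fastforce dest!: subsetD[OF keys_sum] split: if_splits)

text \<open>The cone operator is left exterior multiplication by the vertex \<open>v\<close>.\<close>

definition cone :: "'v::linorder \<Rightarrow> ('v set \<Rightarrow>\<^sub>0 'k::field) \<Rightarrow> ('v set \<Rightarrow>\<^sub>0 'k)" where
  "cone v = chain_lift
     (\<lambda>F a. if v \<in> F then 0 else Poly_Mapping.single (insert v F) (vertex_sign v F * a))"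

lemma additive_cone_single:
  "Modules.additive
     (\<lambda>a. if v \<in> F then 0 else Poly_Mapping.single (insert v F) (vertex_sign v F * a))"
  by standard (simp add: distrib_left single_add)

interpretation cone: Modules.additive "cone v" for v
  unfolding cone_def by (rule additive_chain_lift) (rule additive_cone_single)

lemma cone_single:
  "cone v (Poly_Mapping.single F a) =
     (if v \<in> F then 0 else Poly_Mapping.single (insert v F) (vertex_sign v F * a))"
  unfolding cone_def by (rule chain_lift_single) (rule additive_cone_single)

lemma keys_cone:
  assumes "F \<in> Poly_Mapping.keys (cone v c)"
  obtains G where "G \<in> Poly_Mapping.keys c" "v \<notin> G" "F = insert v G"
  using assms unfolding cone_def chain_lift_def
  by (fastforce dest!: subsetD[OF keys_sum] split: if_splits)

text \<open>Deleting \<open>u\<close> and inserting \<open>v\<close> anticommute: the smaller of the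
  two vertices is counted below the larger one, so exactly one of the two counts changes, and by
  one.\<close>

lemma vertex_sign_swap:
  assumes "finite F" "u \<in> F" "v \<notin> F"
  shows "vertex_sign u (insert v F) * vertex_sign v F =
    - (vertex_sign v (F - {u}) * vertex_sign u F :: 'k::field)"
proof (cases "u < v")
  case True
  have "{w \<in> F. w < v} = insert u {w \<in> F - {u}. w < v}"
    "{w \<in> insert v F. w < u} = {w \<in> F. w < u}"
    using True assms by auto
  then show ?thesis
    using assms by (simp add: vertex_sign_def)
next
  case False
  then have "v < u" using assms(2,3) by (metis linorder_neqE)
  then have "{w \<in> insert v F. w < u} = insert v {w \<in> F. w < u}"
    "{w \<in> F - {u}. w < v} = {w \<in> F. w < v}"
    by auto
  then show ?thesis
    using assms by (simp add: vertex_sign_def)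
qed

text \<open>The cone operator is a contracting homotopy. On a face containing \<open>v\<close> the
  cone vanishes, and of the boundary only the deletion of \<open>v\<close> survives coning and
  restores the face. On any other face, deleting \<open>v\<close> from the cone restores the face,
  and the other deletions anticommute with coning.\<close>

lemma boundary_cone:
  assumes "\<And>F. F \<in> Poly_Mapping.keys c \<Longrightarrow> finite F"
  shows "boundary (cone v c) = c - cone v (boundary c)"
proof (rule additive_eq_on_singles[where f = "\<lambda>c. boundary (cone v c)"
      and g = "\<lambda>c. c - cone v (boundary c)"])
  fix F and a :: 'b assume "F \<in> Poly_Mapping.keys c"
  then have F: "finite F" using assms by auto
  show "boundary (cone v (Poly_Mapping.single F a)) =
    Poly_Mapping.single F a - cone v (boundary (Poly_Mapping.single F a))"
  proof (cases "v \<in> F")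
    case True
    have "cone v (boundary (Poly_Mapping.single F a)) = (\<Sum>u\<in>F. if u = v then Poly_Mapping.single F a else 0)"
      unfolding boundary_single cone.sum
    proof (rule sum.cong[OF refl])
      fix u assume "u \<in> F"
      have "vertex_sign v (F - {v}) = (vertex_sign v F :: 'b)"
        unfolding vertex_sign_def by (rule arg_cong[where f = "\<lambda>S. (-1) ^ card S"]) auto
      then show "cone v (Poly_Mapping.single (F - {u}) (vertex_sign u F * a)) =
        (if u = v then Poly_Mapping.single F a else 0)"
        using True by (auto simp: cone_single insert_absorb vertex_sign_square)
    qed
    then show ?thesis
      using True F by (simp add: cone_single boundary.zero)
  next
    case False
    have "vertex_sign v (insert v F) = (vertex_sign v F :: 'b)"
      unfolding vertex_sign_def by (rule arg_cong[where f = "\<lambda>S. (-1) ^ card S"]) auto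
    moreover have "(\<Sum>u\<in>F. Poly_Mapping.single (insert v F - {u}) (vertex_sign u (insert v F) * (vertex_sign v F * a))) =
      - cone v (boundary (Poly_Mapping.single F a))"
      unfolding boundary_single cone.sum sum_negf[symmetric]
    proof (rule sum.cong[OF refl])
      fix u assume u: "u \<in> F"
      then have "insert v F - {u} = insert v (F - {u})" using False by auto
      then show "Poly_Mapping.single (insert v F - {u}) (vertex_sign u (insert v F) * (vertex_sign v F * a)) =
        - cone v (Poly_Mapping.single (F - {u}) (vertex_sign u F * a))"
        using vertex_sign_swap[OF F u False, where ?'k = 'b] False
        by (simp add: cone_single flip: mult.assoc single_uminus)
    qed
    ultimately show ?thesis
      using False F by (simp add: cone_single boundary_single vertex_sign_square)
  qed
qed (auto intro!: Modules.additive.intro simp: boundary.add cone.add)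

text \<open>By the cone identity, \<open>\<partial>\<partial>(v \<and> c) = v \<and> \<partial>\<partial>c\<close>, and every face is obtained from the
  empty face by successive exterior multiplications, up to sign.\<close>

lemma boundary_boundary_single:
  "finite F \<Longrightarrow> boundary (boundary (Poly_Mapping.single F a)) = 0"
proof (induction F arbitrary: a rule: finite_induct)
  case empty
  then show ?case by (simp add: boundary_single boundary.zero)
next
  case (insert v F)
  define c where "c = Poly_Mapping.single F (vertex_sign v F * a)"
  have c: "Poly_Mapping.single (insert v F) a = cone v c"
    using insert by (simp add: c_def cone_single vertex_sign_square)
  have "boundary (cone v c) = c - cone v (boundary c)"
    by (rule boundary_cone) (use insert in \<open>auto simp: c_def split: if_splits\<close>)
  moreover have "boundary (cone v (boundary c)) = boundary c - cone v (boundary (boundary c))"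
    by (rule boundary_cone)
      (use insert in \<open>auto simp: c_def split: if_splits elim!: keys_boundary\<close>)
  moreover have "boundary (boundary c) = 0"
    using insert.IH by (simp add: c_def)
  ultimately show ?case
    by (simp add: c boundary.diff cone.zero)
qed

lemma boundary_boundary:
  assumes "\<And>F. F \<in> Poly_Mapping.keys c \<Longrightarrow> finite F"
  shows "boundary (boundary c) = 0"
  by (rule additive_eq_on_singles[where f = "\<lambda>c. boundary (boundary c)" and g = "\<lambda>c. 0"])
    (auto intro!: Modules.additive.intro simp: boundary.add boundary_boundary_single assms)

section \<open>Projection of chains to a set of faces\<close>

definition chain_part :: "'a set \<Rightarrow> ('a \<Rightarrow>\<^sub>0 'k::field) \<Rightarrow> ('a \<Rightarrow>\<^sub>0 'k)" where
  "chain_part S = Poly_Mapping.mapp (\<lambda>F a. if F \<in> S then a else 0)"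

lemma lookup_chain_part:
  "Poly_Mapping.lookup (chain_part S c) F = (if F \<in> S then Poly_Mapping.lookup c F else 0)"
  by (auto simp: chain_part_def lookup_mapp when_def in_keys_iff)

lemma keys_chain_part: "Poly_Mapping.keys (chain_part S c) = Poly_Mapping.keys c \<inter> S"
  by (auto simp: in_keys_iff lookup_chain_part split: if_splits)

interpretation chain_part: Modules.additive "chain_part S" for S
  by standard (auto intro!: poly_mapping_eqI simp: lookup_chain_part lookup_add)

lemma chain_part_split: "c = chain_part S c + chain_part (- S) c"
  by (rule poly_mapping_eqI) (simp add: lookup_add lookup_chain_part)

lemma chain_part_eq_0: "Poly_Mapping.keys c \<inter> S = {} \<Longrightarrow> chain_part S c = 0"
  by (metis keys_chain_part keys_eq_empty)

text \<open>By assumption no face of \<open>c\<close> outside \<open>S\<close> loses a vertex to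
  land in \<open>S\<close>, so the part of \<open>c\<close> outside \<open>S\<close> contributes
  nothing. On such chains \<open>chain_part S\<close> behaves like the projection to a quotient
  complex.\<close>

lemma chain_part_boundary:
  assumes "\<And>F v. F \<in> Poly_Mapping.keys c \<Longrightarrow> v \<in> F \<Longrightarrow> F - {v} \<in> S \<Longrightarrow> F \<in> S"
  shows "chain_part S (boundary c) = chain_part S (boundary (chain_part S c))"
proof -
  have "chain_part S (boundary (chain_part (- S) c)) = 0"
    using assms by (intro chain_part_eq_0) (auto simp: keys_chain_part elim!: keys_boundary)
  then show ?thesis
    by (metis add.right_neutral boundary.add chain_part.add chain_part_split)
qed

subsection \<open>Vanishing of reduced homology\<close>

lemma simplicial_complexD:
  assumes "simplicial_complex K"
  shows "{} \<in> K" "F \<in> K \<Longrightarrow> finite F" "F \<in> K \<Longrightarrow> G \<subseteq> F \<Longrightarrow> G \<in> K"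
  using assms by (auto simp: simplicial_complex_def)

lemma simplicial_complex_Pow: "finite S \<Longrightarrow> simplicial_complex (Pow S)"
  by (auto simp: simplicial_complex_def intro: finite_subset)

lemma simplicial_chains_iff:
  "c \<in> simplicial_chains q K \<longleftrightarrow> (\<forall>F\<in>Poly_Mapping.keys c. F \<in> K \<and> int (card F) = q + 1)"
  by (auto simp: simplicial_chains_def)

lemma simplicial_chains_mono: "K \<subseteq> L \<Longrightarrow> simplicial_chains q K \<subseteq> simplicial_chains q L"
  by (auto simp: simplicial_chains_def)

lemma zero_simplicial_chains: "0 \<in> simplicial_chains q K"
  by (simp add: simplicial_chains_iff)

lemma add_simplicial_chains:
  "c \<in> simplicial_chains q K \<Longrightarrow> d \<in> simplicial_chains q K \<Longrightarrow> c + d \<in> simplicial_chains q K"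
  unfolding simplicial_chains_def using keys_add[of c d] by auto

lemma uminus_simplicial_chains:
  "c \<in> simplicial_chains q K \<Longrightarrow> - c \<in> simplicial_chains q K"
  by (simp add: simplicial_chains_def)

lemma diff_simplicial_chains:
  "c \<in> simplicial_chains q K \<Longrightarrow> d \<in> simplicial_chains q K \<Longrightarrow> c - d \<in> simplicial_chains q K"
  unfolding simplicial_chains_def using keys_diff[of c d] by auto

lemma sum_simplicial_chains:
  "(\<And>i. i \<in> I \<Longrightarrow> c i \<in> simplicial_chains q K) \<Longrightarrow> (\<Sum>i\<in>I. c i) \<in> simplicial_chains q K"
  unfolding simplicial_chains_def using keys_sum[of c I] by blast

lemma chain_part_simplicial_chains:
  "c \<in> simplicial_chains q K \<Longrightarrow> K \<inter> S \<subseteq> L \<Longrightarrow> chain_part S c \<in> simplicial_chains q L"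
  by (auto simp: simplicial_chains_iff keys_chain_part)

lemma boundary_simplicial_chains:
  assumes "simplicial_complex K" "c \<in> simplicial_chains q K"
  shows "boundary c \<in> simplicial_chains (q - 1) K"
  unfolding simplicial_chains_iff
proof
  fix F assume "F \<in> Poly_Mapping.keys (boundary c)"
  then obtain G v where G: "G \<in> Poly_Mapping.keys c" "v \<in> G" "F = G - {v}"
    by (rule keys_boundary)
  then have "G \<in> K" "int (card G) = q + 1" using assms(2) by (auto simp: simplicial_chains_iff)
  moreover from this have "card G = Suc (card F)"
    using G simplicial_complexD(2)[OF assms(1), of G] card_Suc_Diff1[of G v] by simp
  moreover have "F \<in> K"
    using simplicial_complexD(3)[OF assms(1) \<open>G \<in> K\<close>, of F] G(3) by blast
  ultimately show "F \<in> K \<and> int (card F) = q - 1 + 1" by simp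
qed

lemma boundary_boundary_chain:
  "simplicial_complex K \<Longrightarrow> c \<in> simplicial_chains q K \<Longrightarrow> boundary (boundary c) = 0"
  by (rule boundary_boundary) (auto simp: simplicial_chains_iff dest: simplicial_complexD(2))

lemma boundary_cone_chain:
  "simplicial_complex K \<Longrightarrow> c \<in> simplicial_chains q K \<Longrightarrow>
    boundary (cone v c) = c - cone v (boundary c)"
  by (rule boundary_cone) (auto simp: simplicial_chains_iff dest: simplicial_complexD(2))

lemma cone_simplicial_chains:
  assumes "\<And>F. F \<in> Poly_Mapping.keys c \<Longrightarrow> v \<notin> F \<Longrightarrow>
    finite F \<and> insert v F \<in> K \<and> int (card F) = q"
  shows "cone v c \<in> simplicial_chains q K"
  unfolding simplicial_chains_iff
proof
  fix F assume "F \<in> Poly_Mapping.keys (cone v c)"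
  then obtain G where "G \<in> Poly_Mapping.keys c" "v \<notin> G" "F = insert v G"
    by (rule keys_cone)
  with assms[of G] show "F \<in> K \<and> int (card F) = q + 1" by simp
qed

text \<open>Chain-level form of vanishing homology, which allows diagram chases with explicit
  chains; \<open>trivial_reduced_homology_iff\<close> links it to the quotient group.\<close>

definition exact_at :: "'k::field itself \<Rightarrow> int \<Rightarrow> 'v::linorder set set \<Rightarrow> bool" where
  "exact_at k q K \<longleftrightarrow> (cycles q K :: ('v set \<Rightarrow>\<^sub>0 'k) set) \<subseteq> boundaries q K"

lemma exact_atI:
  fixes K :: "'v::linorder set set"
  assumes "\<And>z :: 'v set \<Rightarrow>\<^sub>0 'k::field. z \<in> simplicial_chains q K \<Longrightarrow> boundary z = 0 \<Longrightarrow>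
    \<exists>b\<in>simplicial_chains (q + 1) K. boundary b = z"
  shows "exact_at TYPE('k) q K"
  unfolding exact_at_def cycles_def boundaries_def using assms by blast

lemma exact_atE:
  fixes z :: "'v::linorder set \<Rightarrow>\<^sub>0 'k::field"
  assumes "exact_at TYPE('k) q K" "z \<in> simplicial_chains q K" "boundary z = 0"
  obtains b where "b \<in> simplicial_chains (q + 1) K" "boundary b = z"
  using assms unfolding exact_at_def cycles_def boundaries_def by blast

lemma comm_group_cycle_group:
  "comm_group (cycle_group q K :: ('v::linorder set \<Rightarrow>\<^sub>0 'k::field) monoid)"
proof (rule comm_groupI)
  fix c :: "'v set \<Rightarrow>\<^sub>0 'k" assume "c \<in> carrier (cycle_group q K)"
  then have "- c \<in> cycles q K"
    by (simp add: cycle_group_def cycles_def uminus_simplicial_chains boundary.minus)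
  then show "\<exists>d\<in>carrier (cycle_group q K).
      d \<otimes>\<^bsub>cycle_group q K\<^esub> c = \<one>\<^bsub>cycle_group q K\<^esub>"
    by (auto simp: cycle_group_def intro!: bexI[of _ "- c"])
qed (auto simp: cycle_group_def cycles_def boundary.add boundary.zero zero_simplicial_chains
    add_simplicial_chains add_ac)

lemma subgroup_boundaries:
  fixes K :: "'v::linorder set set"
  assumes "simplicial_complex K"
  shows "subgroup (boundaries q K) (cycle_group q K :: ('v set \<Rightarrow>\<^sub>0 'k::field) monoid)"
proof -
  interpret G: comm_group "cycle_group q K :: ('v set \<Rightarrow>\<^sub>0 'k) monoid"
    by (rule comm_group_cycle_group)
  have sub: "boundaries q K \<subseteq> (cycles q K :: ('v set \<Rightarrow>\<^sub>0 'k) set)"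
    using boundary_simplicial_chains[OF assms, of _ "q + 1"] boundary_boundary_chain[OF assms]
    by (auto simp: boundaries_def cycles_def)
  show ?thesis
  proof (rule G.subgroupI)
    show "boundaries q K \<subseteq> carrier (cycle_group q K :: ('v set \<Rightarrow>\<^sub>0 'k) monoid)"
      using sub by (simp add: cycle_group_def)
    show "boundaries q K \<noteq> ({} :: ('v set \<Rightarrow>\<^sub>0 'k) set)"
      using zero_simplicial_chains by (auto simp: boundaries_def)
    fix c :: "'v set \<Rightarrow>\<^sub>0 'k" assume c: "c \<in> boundaries q K"
    then obtain b where b: "b \<in> simplicial_chains (q + 1) K" "c = boundary b"
      by (auto simp: boundaries_def)
    then have minus: "- c \<in> boundaries q K"
      by (auto simp: boundaries_def boundary.minus intro!: image_eqI[of _ _ "- b"] uminus_simplicial_chains)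
    have "inv\<^bsub>cycle_group q K\<^esub> c = - c"
      by (rule G.inv_equality) (use sub c minus in \<open>auto simp: cycle_group_def\<close>)
    then show "inv\<^bsub>cycle_group q K\<^esub> c \<in> boundaries q K" using minus by simp
  next
    fix c d :: "'v set \<Rightarrow>\<^sub>0 'k" assume "c \<in> boundaries q K" "d \<in> boundaries q K"
    then show "c \<otimes>\<^bsub>cycle_group q K\<^esub> d \<in> boundaries q K"
      by (auto simp: boundaries_def cycle_group_def boundary.add[symmetric]
          intro!: imageI add_simplicial_chains)
  qed
qed

lemma (in normal) trivial_factgroup_iff: "trivial_group (G Mod H) \<longleftrightarrow> carrier G \<subseteq> H"
proof
  assume "trivial_group (G Mod H)"
  then have "rcosets H = {H}" by (simp add: trivial_group_def FactGroup_def)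
  then show "carrier G \<subseteq> H"
    using rcos_self[OF _ subgroup_axioms] rcosetsI[OF subset] by auto
next
  assume "carrier G \<subseteq> H"
  then have "carrier (G Mod H) \<subseteq> {\<one>\<^bsub>G Mod H\<^esub>}"
    using coset_join2[OF _ subgroup_axioms] by (auto simp: FactGroup_def RCOSETS_def)
  then show "trivial_group (G Mod H)"
    by (simp add: group.trivial_group_subset[OF factorgroup_is_group])
qed

text \<open>In a complex the boundary squares to zero, so the boundaries form a subgroup of the
  cycles, normal by commutativity, and the quotient is trivial exactly when it is taken by the whole
  group.\<close>

lemma trivial_reduced_homology_iff:
  assumes "simplicial_complex K"
  shows "trivial_group (reduced_homology k q K) \<longleftrightarrow> exact_at k q K"
proof -
  have "normal (boundaries q K) (cycle_group q K :: ('a set \<Rightarrow>\<^sub>0 'b) monoid)"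
    using comm_group.normal_iff_subgroup[OF comm_group_cycle_group] subgroup_boundaries[OF assms]
    by blast
  from normal.trivial_factgroup_iff[OF this] show ?thesis
    by (simp add: reduced_homology_def exact_at_def cycle_group_def)
qed

section \<open>Acyclic simplices and removal of cones\<close>

text \<open>Coning from any vertex of \<open>S\<close> fills every cycle. This includes degree -1,
  where a vertex fills the empty face; the empty face alone would leave homology there.\<close>

lemma exact_at_Pow:
  assumes "finite S" "S \<noteq> {}"
  shows "exact_at TYPE('k::field) q (Pow S)"
proof (rule exact_atI)
  fix z :: "'a set \<Rightarrow>\<^sub>0 'k"
  assume z: "z \<in> simplicial_chains q (Pow S)" "boundary z = 0"
  obtain v where "v \<in> S" using assms by blast
  then have "cone v z \<in> simplicial_chains (q + 1) (Pow S)"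
    using z finite_subset[OF _ assms(1)]
    by (intro cone_simplicial_chains) (simp add: simplicial_chains_iff)
  moreover have "boundary (cone v z) = z"
    using boundary_cone_chain[OF simplicial_complex_Pow[OF assms(1)] z(1)] z(2) by (simp add: cone.zero)
  ultimately show "\<exists>b\<in>simplicial_chains (q + 1) (Pow S). boundary b = z" by blast
qed

text \<open>\<open>relative\<close> says that the homology of the pair \<open>(X, L)\<close>
  vanishes, and the two directions are the adjacent pieces of its long exact sequence. As
  \<open>X\<close> is not assumed to be a complex, \<open>boundary (boundary b) = 0\<close> is part
  of \<open>relative\<close>.\<close>

lemma exact_at_subcomplex_iff:
  fixes X :: "'v::linorder set set"
  assumes L: "simplicial_complex L" "L \<subseteq> X"
    and relative: "\<And>q (c :: 'v set \<Rightarrow>\<^sub>0 'k::field). c \<in> simplicial_chains q X \<Longrightarrow>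
      boundary c \<in> simplicial_chains (q - 1) L \<Longrightarrow>
      \<exists>b\<in>simplicial_chains (q + 1) X. boundary (boundary b) = 0 \<and> c - boundary b \<in> simplicial_chains q L"
  shows "exact_at TYPE('k) q X \<longleftrightarrow> exact_at TYPE('k) q L"
proof
  assume X: "exact_at TYPE('k) q X"
  show "exact_at TYPE('k) q L"
  proof (rule exact_atI)
    fix z :: "'v set \<Rightarrow>\<^sub>0 'k" assume z: "z \<in> simplicial_chains q L" "boundary z = 0"
    then have "z \<in> simplicial_chains q X" using simplicial_chains_mono[OF L(2)] by blast
    with X z obtain c where c: "c \<in> simplicial_chains (q + 1) X" "boundary c = z"
      by (blast elim: exact_atE)
    \<comment> \<open>The filling \<open>c\<close> is a relative cycle one degree higher;
      subtracting \<open>boundary b\<close> moves it into \<open>L\<close> without changing its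
      boundary.\<close>
    then obtain b where "boundary (boundary b) = 0" "c - boundary b \<in> simplicial_chains (q + 1) L"
      using relative[of c "q + 1"] z by auto
    then show "\<exists>b\<in>simplicial_chains (q + 1) L. boundary b = z"
      using c by (intro bexI[of _ "c - boundary b"]) (simp_all add: boundary.diff)
  qed
next
  assume ex: "exact_at TYPE('k) q L"
  show "exact_at TYPE('k) q X"
  proof (rule exact_atI)
    fix z :: "'v set \<Rightarrow>\<^sub>0 'k" assume z: "z \<in> simplicial_chains q X" "boundary z = 0"
    then obtain b where b: "b \<in> simplicial_chains (q + 1) X" "boundary (boundary b) = 0"
      "z - boundary b \<in> simplicial_chains q L"
      using relative[of z q] zero_simplicial_chains by metis
    then obtain d where "d \<in> simplicial_chains (q + 1) L" "boundary d = z - boundary b"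
      using ex z by (auto simp: boundary.diff elim: exact_atE)
    then show "\<exists>b\<in>simplicial_chains (q + 1) X. boundary b = z"
      using b simplicial_chains_mono[OF L(2)]
      by (intro bexI[of _ "b + d"]) (auto simp: boundary.add intro: add_simplicial_chains)
  qed
qed

text \<open>Coning contracts chains modulo \<open>L\<close>: for the part \<open>n\<close> of
  \<open>c\<close> outside \<open>L\<close>,
  \<open>boundary (cone v n) = n - cone v (boundary n)\<close>. The assumption \<open>insert\<close>
  keeps the cone in \<open>X\<close>, and \<open>insert_face\<close> keeps the last term in
  \<open>L\<close>.\<close>

lemma exact_at_remove_cone:
  fixes X :: "'v::linorder set set"
  assumes X: "simplicial_complex X" and L: "simplicial_complex L" "L \<subseteq> X"
    and insert: "\<And>F. F \<in> X - L \<Longrightarrow> insert v F \<in> X"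
    and insert_face: "\<And>F u. F \<in> X - L \<Longrightarrow> u \<in> F \<Longrightarrow> F - {u} \<in> L \<Longrightarrow> insert v (F - {u}) \<in> L"
  shows "exact_at TYPE('k::field) q X \<longleftrightarrow> exact_at TYPE('k) q L"
proof (rule exact_at_subcomplex_iff[OF L])
  fix q and c :: "'v set \<Rightarrow>\<^sub>0 'k"
  assume c: "c \<in> simplicial_chains q X" "boundary c \<in> simplicial_chains (q - 1) L"
  define n where "n = chain_part (- L) c"
  have split: "c = chain_part L c + n"
    unfolding n_def by (rule chain_part_split)
  have cL: "chain_part L c \<in> simplicial_chains q L"
    by (rule chain_part_simplicial_chains[OF c(1)]) auto
  have n: "n \<in> simplicial_chains q (X - L)"
    unfolding n_def by (rule chain_part_simplicial_chains[OF c(1)]) auto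
  then have nX: "n \<in> simplicial_chains q X" using simplicial_chains_mono[of "X - L" X] by auto
  have cone_n: "cone v n \<in> simplicial_chains (q + 1) X"
    using n simplicial_complexD(2)[OF X] insert
    by (intro cone_simplicial_chains) (auto simp: simplicial_chains_iff)
  have "boundary n = boundary c - boundary (chain_part L c)"
    by (subst split) (simp add: boundary.add)
  then have bn: "boundary n \<in> simplicial_chains (q - 1) L"
    using c(2) boundary_simplicial_chains[OF L(1) cL] by (simp add: diff_simplicial_chains)
  have "cone v (boundary n) \<in> simplicial_chains q L"
  proof (rule cone_simplicial_chains)
    fix F assume F: "F \<in> Poly_Mapping.keys (boundary n)"
    then have FL: "F \<in> L" "int (card F) = q" using bn by (auto simp: simplicial_chains_iff)
    from F obtain G u where "G \<in> Poly_Mapping.keys n" "u \<in> G" "F = G - {u}" by (rule keys_boundary)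
    moreover from this have "G \<in> X - L" using n by (auto simp: simplicial_chains_iff)
    ultimately have "insert v F \<in> L" using insert_face FL by auto
    then show "finite F \<and> insert v F \<in> L \<and> int (card F) = q"
      using FL simplicial_complexD(2)[OF L(1)] by auto
  qed
  moreover have "c - boundary (cone v n) = chain_part L c + cone v (boundary n)"
    by (subst split) (simp add: boundary_cone_chain[OF X nX])
  ultimately have "c - boundary (cone v n) \<in> simplicial_chains q L"
    using cL by (simp add: add_simplicial_chains)
  then show "\<exists>b\<in>simplicial_chains (q + 1) X. boundary (boundary b) = 0 \<and> c - boundary b \<in> simplicial_chains q L"
    using cone_n boundary_boundary_chain[OF X cone_n] by blast
qed

text \<open>The faces outside \<open>V\<close> are removed fibre by fibre over a maximal trace \<open>F\<close> on the complement
  of \<open>V\<close>; the fibre is a cone, with apex depending on \<open>F\<close>.\<close>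

lemma exact_at_induced_subcomplex:
  fixes X :: "'v::linorder set set"
  assumes "finite X" "simplicial_complex X"
    and "\<And>F. F \<in> X \<Longrightarrow> F \<noteq> {} \<Longrightarrow> F \<inter> V = {} \<Longrightarrow>
      \<exists>v\<in>V. \<forall>G\<in>X. G - V = F \<longrightarrow> insert v G \<in> X"
  shows "exact_at TYPE('k::field) q X \<longleftrightarrow> exact_at TYPE('k) q {F \<in> X. F \<subseteq> V}"
  using assms
proof (induction X rule: finite_psubset_induct)
  case (psubset X)
  show ?case
  proof (cases "\<forall>F\<in>X. F \<subseteq> V")
    case True
    then have "{F \<in> X. F \<subseteq> V} = X" by auto
    then show ?thesis by simp
  next
    case False
    have sub: "F - V \<in> X" if "F \<in> X" for F
      using simplicial_complexD(3)[OF psubset.prems(1) that] by auto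
    define \<F> where "\<F> = {F \<in> X. F \<noteq> {} \<and> F \<inter> V = {}}"
    from False obtain F0 where "F0 \<in> X" "\<not> F0 \<subseteq> V" by blast
    then have "F0 - V \<in> \<F>" using sub[of F0] by (auto simp: \<F>_def)
    moreover have "finite \<F>" using psubset.hyps by (simp add: \<F>_def)
    ultimately obtain F where F: "F \<in> \<F>" and max: "\<And>G. G \<in> \<F> \<Longrightarrow> F \<subseteq> G \<Longrightarrow> G = F"
      by (metis finite_has_maximal empty_iff)
    then obtain v where v: "v \<in> V" "\<And>G. G \<in> X \<Longrightarrow> G - V = F \<Longrightarrow> insert v G \<in> X"
      using psubset.prems(2)[of F] by (auto simp: \<F>_def)
    define L where "L = {G \<in> X. G - V \<noteq> F}"
    have FX: "F \<in> X" "F \<noteq> {}" "F - V = F" using F by (auto simp: \<F>_def)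
    have L: "simplicial_complex L"
      unfolding simplicial_complex_def
    proof (intro conjI ballI allI impI)
      show "{} \<in> L" using FX simplicial_complexD(1)[OF psubset.prems(1)] by (auto simp: L_def)
      fix G assume G: "G \<in> L"
      then show "finite G" using simplicial_complexD(2)[OF psubset.prems(1)] by (auto simp: L_def)
      fix H assume H: "H \<subseteq> G"
      \<comment> \<open>Maximality of \<open>F\<close> makes \<open>L\<close> closed under subsets:
        a superset of \<open>H\<close> has a trace containing \<open>F\<close>, hence equal to
        \<open>F\<close>, and so is not in \<open>L\<close>.\<close>
      have "H - V \<noteq> F"
      proof
        assume HF: "H - V = F"
        then have "F \<subseteq> G - V" using H by auto
        moreover from this have "G - V \<in> \<F>" using G FX sub[of G] by (auto simp: \<F>_def L_def)
        ultimately have "G - V = F" using max by blast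
        then show False using G by (simp add: L_def)
      qed
      then show "H \<in> L" using G H simplicial_complexD(3)[OF psubset.prems(1)] by (auto simp: L_def)
    qed
    have "exact_at TYPE('k) q X \<longleftrightarrow> exact_at TYPE('k) q L"
    proof (rule exact_at_remove_cone[OF psubset.prems(1) L])
      show "L \<subseteq> X" by (auto simp: L_def)
      show "insert v G \<in> X" if "G \<in> X - L" for G
        using that v(2) by (auto simp: L_def)
      fix G u assume G: "G \<in> X - L" "u \<in> G" "G - {u} \<in> L"
      then have GF: "G \<in> X" "G - V = F" "(G - {u}) - V \<noteq> F" by (auto simp: L_def)
      \<comment> \<open>Since \<open>v \<in> V\<close>, inserting \<open>v\<close> does not change
        the trace on the complement of \<open>V\<close>.\<close>
      then have "insert v (G - {u}) - V \<noteq> F" using v(1) by auto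
      moreover have "insert v (G - {u}) \<in> X"
        by (rule simplicial_complexD(3)[OF psubset.prems(1) v(2)[OF GF(1,2)]]) auto
      ultimately show "insert v (G - {u}) \<in> L" by (simp add: L_def)
    qed
    also have "\<dots> \<longleftrightarrow> exact_at TYPE('k) q {G \<in> L. G \<subseteq> V}"
    proof (rule psubset.IH)
      show "L \<subset> X" using FX by (auto simp: L_def)
      show "simplicial_complex L" by (rule L)
      fix G assume G: "G \<in> L" "G \<noteq> {}" "G \<inter> V = {}"
      \<comment> \<open>The apex of a fibre in \<open>X\<close> also serves in \<open>L\<close>,
        because inserting \<open>w \<in> V\<close> preserves the trace.\<close>
      then obtain w where "w \<in> V" "\<And>H. H \<in> X \<Longrightarrow> H - V = G \<Longrightarrow> insert w H \<in> X"
        using psubset.prems(2)[of G] by (auto simp: L_def)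
      then show "\<exists>w\<in>V. \<forall>H\<in>L. H - V = G \<longrightarrow> insert w H \<in> L"
        by (auto simp: L_def insert_Diff_if intro!: bexI[of _ w])
    qed
    also have "{G \<in> L. G \<subseteq> V} = {G \<in> X. G \<subseteq> V}"
      using FX by (auto simp: L_def)
    finally show ?thesis .
  qed
qed

subsection \<open>The nerve lemma\<close>

text \<open>No sign is inserted and no degenerate face is discarded; the map respects boundaries
  when \<open>f\<close> is strictly increasing on the faces involved.\<close>

definition chain_image :: "('v \<Rightarrow> 'w) \<Rightarrow> ('v set \<Rightarrow>\<^sub>0 'k::field) \<Rightarrow> ('w set \<Rightarrow>\<^sub>0 'k)" where
  "chain_image f = chain_lift (\<lambda>F a. Poly_Mapping.single (f ` F) a)"

lemma additive_single: "Modules.additive (Poly_Mapping.single x)"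
  by standard (rule single_add)

interpretation chain_image: Modules.additive "chain_image f" for f
  unfolding chain_image_def by (rule additive_chain_lift) (rule additive_single)

lemma chain_image_single: "chain_image f (Poly_Mapping.single F a) = Poly_Mapping.single (f ` F) a"
  unfolding chain_image_def by (rule chain_lift_single) (rule additive_single)

lemma keys_chain_image: "Poly_Mapping.keys (chain_image f c) \<subseteq> (`) f ` Poly_Mapping.keys c"
  unfolding chain_image_def chain_lift_def
  by (rule order_trans[OF keys_sum]) (auto split: if_splits)

text \<open>A strictly increasing map preserves the number of vertices below a given one, hence each
  sign, and by injectivity it commutes with deleting a vertex.\<close>

lemma boundary_chain_image:
  fixes f :: "'v::linorder \<Rightarrow> 'w::linorder" and c :: "'v set \<Rightarrow>\<^sub>0 'k::field"
  assumes "\<And>F. F \<in> Poly_Mapping.keys c \<Longrightarrow> strict_mono_on F f"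
  shows "boundary (chain_image f c) = chain_image f (boundary c)"
proof (rule additive_eq_on_singles[where f = "\<lambda>c. boundary (chain_image f c)"
      and g = "\<lambda>c. chain_image f (boundary c)"])
  fix F and a :: 'k assume "F \<in> Poly_Mapping.keys c"
  then have f: "strict_mono_on F f" by (rule assms)
  then have inj: "inj_on f F" by (rule strict_mono_on_imp_inj_on)
  have sign: "vertex_sign (f v) (f ` F) = (vertex_sign v F :: 'k)" if "v \<in> F" for v
  proof -
    have "{w \<in> f ` F. w < f v} = f ` {u \<in> F. u < v}"
      using that strict_mono_on_less[OF f] by auto
    moreover have "inj_on f {u \<in> F. u < v}" using inj by (rule inj_on_subset) auto
    ultimately show ?thesis by (simp add: vertex_sign_def card_image)
  qed
  have "f ` F - {f v} = f ` (F - {v})" if "v \<in> F" for v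
    using that inj by (auto simp: inj_on_def)
  then show "boundary (chain_image f (Poly_Mapping.single F a)) =
    chain_image f (boundary (Poly_Mapping.single F a))"
    by (simp add: chain_image_single boundary_single chain_image.sum sum.reindex[OF inj] sign)
qed (auto intro!: Modules.additive.intro simp: boundary.add chain_image.add)

lemma chain_image_simplicial_chains:
  assumes "c \<in> simplicial_chains q K" "inj_on f (\<Union>K)"
  shows "chain_image f c \<in> simplicial_chains q ((`) f ` K)"
  unfolding simplicial_chains_iff
proof
  fix F assume "F \<in> Poly_Mapping.keys (chain_image f c)"
  then obtain G where G: "G \<in> Poly_Mapping.keys c" "F = f ` G" using keys_chain_image[of f c] by blast
  then have K: "G \<in> K" "int (card G) = q + 1" using assms(1) by (auto simp: simplicial_chains_iff)
  then have "card F = card G"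
    using G assms(2) by (metis Union_upper card_image inj_on_subset)
  then show "F \<in> (`) f ` K \<and> int (card F) = q + 1" using G K by auto
qed

text \<open>The inverse of a strictly increasing map between linear orders is strictly increasing,
  so \<open>K\<close> and its image can exchange roles.\<close>

lemma strict_mono_on_faces_inverse:
  fixes f :: "'v::linorder \<Rightarrow> 'w::linorder"
  assumes f: "strict_mono_on (\<Union>K) f"
  obtains g where "strict_mono_on (\<Union>((`) f ` K)) g" "\<And>F. F \<in> K \<Longrightarrow> g ` f ` F = F"
    "(`) g ` (`) f ` K = K"
proof
  let ?g = "inv_into (\<Union>K) f"
  have inj: "inj_on f (\<Union>K)" using f by (rule strict_mono_on_imp_inj_on)
  have Un: "\<Union>((`) f ` K) = f ` \<Union>K" by auto
  show "strict_mono_on (\<Union>((`) f ` K)) ?g"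
    unfolding Un
  proof (rule strict_mono_onI)
    fix x y assume "x \<in> f ` \<Union>K" "y \<in> f ` \<Union>K" "x < y"
    moreover from this obtain a b where "a \<in> \<Union>K" "b \<in> \<Union>K" "x = f a" "y = f b" by blast
    ultimately show "?g x < ?g y"
      using strict_mono_on_less[OF f, of a b] inv_into_f_f[OF inj] by simp
  qed
  show gf: "?g ` f ` F = F" if "F \<in> K" for F
    using that inj by (metis Union_upper inv_into_image_cancel)
  then show "(`) ?g ` (`) f ` K = K" by (simp add: image_image cong: image_cong)
qed

text \<open>A cycle is pushed forward and filled in the image, and the filling is pulled back along
  the inverse.\<close>

lemma exact_at_of_image:
  fixes f :: "'v::linorder \<Rightarrow> 'w::linorder"
  assumes f: "strict_mono_on (\<Union>K) f" and ex: "exact_at TYPE('k::field) q ((`) f ` K)"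
  shows "exact_at TYPE('k) q K"
proof (rule exact_atI)
  fix z :: "'v set \<Rightarrow>\<^sub>0 'k"
  assume z: "z \<in> simplicial_chains q K" "boundary z = 0"
  have inj: "inj_on f (\<Union>K)" using f by (rule strict_mono_on_imp_inj_on)
  obtain g where g: "strict_mono_on (\<Union>((`) f ` K)) g"
    and gf: "\<And>F. F \<in> K \<Longrightarrow> g ` f ` F = F" "(`) g ` (`) f ` K = K"
    using strict_mono_on_faces_inverse[OF f] by blast
  have "boundary (chain_image f z) = chain_image f (boundary z)"
    using z(1) by (intro boundary_chain_image monotone_on_subset[OF f]) (auto simp: simplicial_chains_iff)
  then obtain b where b: "b \<in> simplicial_chains (q + 1) ((`) f ` K)" "boundary b = chain_image f z"
    using ex z chain_image_simplicial_chains[OF z(1) inj] by (auto simp: chain_image.zero elim: exact_atE)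
  have "chain_image g b \<in> simplicial_chains (q + 1) K"
    using chain_image_simplicial_chains[OF b(1) strict_mono_on_imp_inj_on[OF g]] gf(2) by simp
  moreover have "strict_mono_on F g" if "F \<in> Poly_Mapping.keys b" for F
    using b(1) that by (intro monotone_on_subset[OF g] Union_upper) (simp add: simplicial_chains_iff)
  then have "boundary (chain_image g b) = chain_image g (chain_image f z)"
    using b(2) by (simp add: boundary_chain_image)
  moreover have "chain_image g (chain_image f z) = z"
    by (rule additive_eq_on_singles[where f = "\<lambda>z. chain_image g (chain_image f z)" and g = "\<lambda>z. z"])
      (use z(1) gf(1) in \<open>auto intro!: Modules.additive.intro
        simp: chain_image.add chain_image_single simplicial_chains_iff\<close>)
  ultimately show "\<exists>b\<in>simplicial_chains (q + 1) K. boundary b = z" by metis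
qed

lemma exact_at_image_iff:
  fixes f :: "'v::linorder \<Rightarrow> 'w::linorder"
  assumes f: "strict_mono_on (\<Union>K) f"
  shows "exact_at TYPE('k::field) q ((`) f ` K) \<longleftrightarrow> exact_at TYPE('k) q K"
proof
  obtain g where g: "strict_mono_on (\<Union>((`) f ` K)) g" and gf: "(`) g ` (`) f ` K = K"
    by (rule strict_mono_on_faces_inverse[OF f])
  assume "exact_at TYPE('k) q K"
  then have "exact_at TYPE('k) q ((`) g ` (`) f ` K)" by (simp only: gf)
  then show "exact_at TYPE('k) q ((`) f ` K)" by (rule exact_at_of_image[OF g])
qed (rule exact_at_of_image[OF f])

text \<open>Both complexes are induced subcomplexes of the complex \<open>X\<close> of all disjoint unions \<open>G \<union> F\<close>
  with \<open>G\<close> contained in every \<open>B l\<close>, \<open>l \<in> F\<close>. The lexicographically ordered type \<open>'v \<times> nat\<close>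
  provides room for both vertex sets.\<close>

lemma nerve_lemma:
  fixes B :: "nat \<Rightarrow> 'v::linorder set"
  assumes S: "finite S" "S \<noteq> {}" and B: "\<And>l. l \<in> S \<Longrightarrow> finite (B l)"
  shows "exact_at TYPE('k::field) q {G. \<exists>l\<in>S. G \<subseteq> B l} \<longleftrightarrow>
    exact_at TYPE('k) q {F. F \<subseteq> S \<and> (F = {} \<or> (\<Inter>l\<in>F. B l) \<noteq> {})}"
    (is "exact_at _ _ ?K \<longleftrightarrow> exact_at _ _ ?N")
proof -
  \<comment> \<open>The second component, \<open>0\<close> for \<open>f\<close> and positive for
    \<open>g\<close>, keeps the vertex sets apart; the constant first component of \<open>g\<close>
    makes the lexicographic order follow \<open>l\<close>.\<close>
  define f :: "'v \<Rightarrow> 'v \<times> nat" where "f v = (v, 0)" for v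
  define g :: "nat \<Rightarrow> 'v \<times> nat" where "g l = (undefined, Suc l)" for l
  have fg: "f v = f v' \<longleftrightarrow> v = v'" "g l = g l' \<longleftrightarrow> l = l'" "f v \<noteq> g l" "g l \<noteq> f v" for v v' l l'
    by (auto simp: f_def g_def)
  have mono: "strict_mono_on P f" "strict_mono_on Q g" for P Q
    by (auto simp: strict_mono_on_def f_def g_def)
  define X where "X = {H. H \<subseteq> range f \<union> range g \<and> f -` H \<in> ?K \<and> g -` H \<in> ?N \<and>
    (\<forall>l\<in>g -` H. f -` H \<subseteq> B l)}"
  have "finite (f ` (\<Union>l\<in>S. B l) \<union> g ` S)" using S B by blast
  moreover have "X \<subseteq> Pow (f ` (\<Union>l\<in>S. B l) \<union> g ` S)"
  proof (intro subsetI PowI)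
    fix H x assume H: "H \<in> X" and x: "x \<in> H"
    then consider v where "x = f v" "v \<in> f -` H" | l where "x = g l" "l \<in> g -` H"
      unfolding X_def by blast
    then show "x \<in> f ` (\<Union>l\<in>S. B l) \<union> g ` S"
    proof cases
      case 1
      moreover obtain l where "l \<in> S" "f -` H \<subseteq> B l" using H by (auto simp: X_def)
      ultimately show ?thesis by blast
    qed (use H in \<open>auto simp: X_def\<close>)
  qed
  ultimately have fin: "finite X" and finH: "\<And>H. H \<in> X \<Longrightarrow> finite H"
    by (auto simp: finite_subset intro: finite_subset)
  have X: "simplicial_complex X"
    unfolding simplicial_complex_def
  proof (intro conjI ballI allI impI)
    show "{} \<in> X" using S by (auto simp: X_def)
    fix H assume H: "H \<in> X"
    then show "finite H" by (rule finH)
    fix H' assume H': "H' \<subseteq> H"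
    have "f -` H' \<subseteq> f -` H" using H' by auto
    moreover obtain l where "l \<in> S" "f -` H \<subseteq> B l" using H by (auto simp: X_def)
    ultimately have "f -` H' \<in> ?K" by blast
    moreover have "H' \<subseteq> range f \<union> range g" using H H' by (auto simp: X_def)
    moreover have "g -` H' \<in> ?N"
    proof -
      have "g -` H' \<subseteq> g -` H" using H' by auto
      moreover from this have "(\<Inter>l\<in>g -` H. B l) \<subseteq> (\<Inter>l\<in>g -` H'. B l)"
        by (intro INF_superset_mono) auto
      moreover have "g -` H \<in> ?N" using H by (simp add: X_def)
      ultimately show ?thesis by blast
    qed
    moreover have "\<forall>l\<in>g -` H. f -` H \<subseteq> B l" using H by (simp add: X_def)
    then have "\<forall>l\<in>g -` H'. f -` H' \<subseteq> B l" using H' by blast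
    ultimately show "H' \<in> X" by (simp add: X_def)
  qed
  have "exact_at TYPE('k) q X \<longleftrightarrow> exact_at TYPE('k) q {H \<in> X. H \<subseteq> range f}"
  proof (rule exact_at_induced_subcomplex[OF fin X])
    fix F assume F: "F \<in> X" "F \<noteq> {}" "F \<inter> range f = {}"
    have "F \<subseteq> range f \<union> range g" using F(1) by (simp add: X_def)
    then have ne: "g -` F \<noteq> {}" using F(2,3) by blast
    \<comment> \<open>The trace is a nonempty face of the nerve, so its sets share a point
      \<open>v\<close>, and \<open>f v\<close> is the apex for the whole fibre.\<close>
    then obtain v where v: "v \<in> (\<Inter>l\<in>g -` F. B l)" using F by (auto simp: X_def)
    have "insert (f v) G \<in> X" if G: "G \<in> X" "G - range f = F" for G
    proof -
      have "f -` insert (f v) G = insert v (f -` G)" "g -` insert (f v) G = g -` G" "g -` G = g -` F"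
        using G(2) by (auto simp: fg)
      moreover obtain l where "l \<in> g -` F" using ne by blast
      then have "insert v (f -` G) \<subseteq> B l" "l \<in> S"
        using G(1) v \<open>g -` G = g -` F\<close> by (auto simp: X_def)
      then have "insert v (f -` G) \<in> ?K" by blast
      ultimately show ?thesis using G(1) v by (simp add: X_def)
    qed
    then show "\<exists>w\<in>range f. \<forall>G\<in>X. G - range f = F \<longrightarrow> insert w G \<in> X" by blast
  qed
  moreover have "exact_at TYPE('k) q X \<longleftrightarrow> exact_at TYPE('k) q {H \<in> X. H \<subseteq> range g}"
  proof (rule exact_at_induced_subcomplex[OF fin X])
    fix F assume F: "F \<in> X" "F \<noteq> {}" "F \<inter> range g = {}"
    have "F \<subseteq> range f \<union> range g" using F(1) by (simp add: X_def)
    then have ne: "f -` F \<noteq> {}" using F(2,3) by blast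
    \<comment> \<open>Here the apex is \<open>g l\<close> for some \<open>B l\<close> that contains
      the trace; the nonempty trace then lies in all sets of the enlarged index set, which is
      therefore still a face of the nerve.\<close>
    obtain l where l: "l \<in> S" "f -` F \<subseteq> B l" using F by (auto simp: X_def)
    have "insert (g l) G \<in> X" if G: "G \<in> X" "G - range g = F" for G
    proof -
      have *: "g -` insert (g l) G = insert l (g -` G)" "f -` insert (g l) G = f -` G" "f -` G = f -` F"
        using G(2) by (auto simp: fg)
      have B: "\<forall>l'\<in>insert l (g -` G). f -` F \<subseteq> B l'" using G(1) l(2) *(3) by (simp add: X_def)
      then have "f -` F \<subseteq> (\<Inter>l'\<in>insert l (g -` G). B l')" by blast
      moreover have "g -` G \<subseteq> S" using G(1) by (simp add: X_def)
      ultimately have "insert l (g -` G) \<in> ?N" using ne l(1) by blast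
      then show ?thesis using G(1) B * unfolding X_def by simp
    qed
    then show "\<exists>w\<in>range g. \<forall>G\<in>X. G - range g = F \<longrightarrow> insert w G \<in> X" by blast
  qed
  moreover have "{H \<in> X. H \<subseteq> range f} = (`) f ` ?K"
  proof (intro equalityI subsetI)
    fix H assume "H \<in> {H \<in> X. H \<subseteq> range f}"
    then have "H = f ` (f -` H)" "f -` H \<in> ?K" by (auto simp: X_def)
    then show "H \<in> (`) f ` ?K" by blast
  next
    fix H assume "H \<in> (`) f ` ?K"
    then obtain G where "G \<in> ?K" "H = f ` G" by blast
    moreover have "f -` f ` G = G" "g -` f ` G = {}" by (auto simp: fg)
    ultimately show "H \<in> {H \<in> X. H \<subseteq> range f}" by (auto simp: X_def)
  qed
  moreover have "{H \<in> X. H \<subseteq> range g} = (`) g ` ?N"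
  proof (intro equalityI subsetI)
    fix H assume "H \<in> {H \<in> X. H \<subseteq> range g}"
    then have "H = g ` (g -` H)" "g -` H \<in> ?N" by (auto simp: X_def)
    then show "H \<in> (`) g ` ?N" by blast
  next
    fix H assume "H \<in> (`) g ` ?N"
    then obtain F where "F \<in> ?N" "H = g ` F" by blast
    moreover have "g -` g ` F = F" "f -` g ` F = {}" by (auto simp: fg)
    ultimately show "H \<in> {H \<in> X. H \<subseteq> range g}" using S by (auto simp: X_def)
  qed
  ultimately show ?thesis
    using exact_at_image_iff[OF mono(1), where ?'k = 'k and K = ?K and q = q]
      exact_at_image_iff[OF mono(2), where ?'k = 'k and K = ?N and q = q] by simp
qed

subsection \<open>Filtration by the higher nerves\<close>

lemma nerve_complex_0: "nerve_complex r A 0 = Pow {1..r}"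
  by (auto simp: nerve_complex_def)

text \<open>Smaller index sets have larger intersections; finiteness of the \<open>A l\<close> turns
  this into an inequality of cardinalities.\<close>

lemma simplicial_complex_nerve_complex:
  assumes "\<And>l. l \<in> {1..r} \<Longrightarrow> finite (A l)"
  shows "simplicial_complex (nerve_complex r A j)"
  unfolding simplicial_complex_def
proof (intro conjI ballI allI impI)
  show "{} \<in> nerve_complex r A j" by (simp add: nerve_complex_def)
  fix F assume F: "F \<in> nerve_complex r A j"
  then show "finite F" by (auto simp: nerve_complex_def intro: finite_subset)
  fix G assume G: "G \<subseteq> F"
  show "G \<in> nerve_complex r A j"
  proof (cases "G = {}")
    case False
    moreover have "G \<subseteq> {1..r}" using F G by (auto simp: nerve_complex_def)
    ultimately have "finite (\<Inter>l\<in>G. A l)" using assms by (intro finite_INT) blast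
    then have "card (\<Inter>l\<in>F. A l) \<le> card (\<Inter>l\<in>G. A l)" using G by (intro card_mono INF_superset_mono) auto
    then show ?thesis using F G False by (auto simp: nerve_complex_def)
  qed (simp add: nerve_complex_def)
qed

text \<open>These faces span the summand of the relative complex that belongs to \<open>T\<close>.
  The empty face is excluded because it lies in every nerve.\<close>

definition nerve_fibre :: "nat \<Rightarrow> (nat \<Rightarrow> 'v set) \<Rightarrow> 'v set \<Rightarrow> nat set set" where
  "nerve_fibre r A T = {F. F \<subseteq> {1..r} \<and> F \<noteq> {} \<and> (\<Inter>l\<in>F. A l) = T}"

text \<open>The nerve of the cover of the link of \<open>T\<close> by the sets \<open>A l - T\<close>.\<close>

definition link_nerve :: "nat \<Rightarrow> (nat \<Rightarrow> 'v set) \<Rightarrow> 'v set \<Rightarrow> nat set set" where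
  "link_nerve r A T = Pow {l \<in> {1..r}. T \<subseteq> A l} - nerve_fibre r A T"

lemma nerve_fibre_subset: "nerve_fibre r A T \<subseteq> Pow {l \<in> {1..r}. T \<subseteq> A l}"
  by (auto simp: nerve_fibre_def)

text \<open>The intersection over a nonempty face of the link nerve properly contains
  \<open>T\<close>, so it has at least one more element.\<close>

lemma link_nerve_subset:
  assumes "\<And>l. l \<in> {1..r} \<Longrightarrow> finite (A l)"
  shows "link_nerve r A T \<subseteq> nerve_complex r A (Suc (card T))"
proof
  fix F assume F: "F \<in> link_nerve r A T"
  show "F \<in> nerve_complex r A (Suc (card T))"
  proof (cases "F = {}")
    case False
    then have "T \<subset> (\<Inter>l\<in>F. A l)" using F by (auto simp: link_nerve_def nerve_fibre_def)
    moreover have "finite (\<Inter>l\<in>F. A l)"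
      using assms F False by (intro finite_INT) (auto simp: link_nerve_def)
    ultimately have "card T < card (\<Inter>l\<in>F. A l)" by (intro psubset_card_mono)
    then show ?thesis using F by (auto simp: nerve_complex_def link_nerve_def)
  qed (simp add: nerve_complex_def)
qed

lemma nerve_complex_Suc_subset: "nerve_complex r A (Suc j) \<subseteq> nerve_complex r A j"
  by (auto simp: nerve_complex_def)

lemma star_subset_nerve_complex:
  assumes "\<And>l. l \<in> {1..r} \<Longrightarrow> finite (A l)"
  shows "Pow {l \<in> {1..r}. T \<subseteq> A l} \<subseteq> nerve_complex r A (card T)"
proof
  fix F assume F: "F \<in> Pow {l \<in> {1..r}. T \<subseteq> A l}"
  show "F \<in> nerve_complex r A (card T)"
  proof (cases "F \<in> nerve_fibre r A T")
    case True
    then show ?thesis by (auto simp: nerve_fibre_def nerve_complex_def)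
  next
    case False
    then have "F \<in> link_nerve r A T" using F by (simp add: link_nerve_def)
    then show ?thesis
      using link_nerve_subset[of r A T] assms nerve_complex_Suc_subset[of r A "card T"] by blast
  qed
qed

text \<open>If deleting a vertex from a face of this nerve gives intersection \<open>T\<close>, the
  intersection over the face itself lies in \<open>T\<close> and has at least \<open>card T\<close>
  elements, so it equals \<open>T\<close>. Hence no face enters the fibre from outside.\<close>

lemma chain_part_nerve_fibre_boundary:
  assumes A: "\<And>l. l \<in> {1..r} \<Longrightarrow> finite (A l)"
    and c: "c \<in> simplicial_chains q (nerve_complex r A (card T))"
  shows "chain_part (nerve_fibre r A T) (boundary c) =
    chain_part (nerve_fibre r A T) (boundary (chain_part (nerve_fibre r A T) c))"
proof (rule chain_part_boundary)
  fix F v assume F: "F \<in> Poly_Mapping.keys c" "v \<in> F" "F - {v} \<in> nerve_fibre r A T"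
  then have N: "F \<in> nerve_complex r A (card T)" using c by (auto simp: simplicial_chains_iff)
  have T: "(\<Inter>l\<in>F - {v}. A l) = T" "F - {v} \<noteq> {}" "F - {v} \<subseteq> {1..r}"
    using F by (auto simp: nerve_fibre_def)
  then have "finite T" using A by (metis finite_INT equals0I subsetD)
  moreover have "(\<Inter>l\<in>F. A l) \<subseteq> T" unfolding T(1)[symmetric] by (intro INF_superset_mono) auto
  moreover have "card T \<le> card (\<Inter>l\<in>F. A l)" using N F by (auto simp: nerve_complex_def)
  ultimately have "(\<Inter>l\<in>F. A l) = T" by (metis card_seteq)
  then show "F \<in> nerve_fibre r A T" using N F by (auto simp: nerve_fibre_def nerve_complex_def)
qed

section \<open>Diagram chases between consecutive nerves\<close>

text \<open>The cycle \<open>z\<close> is filled by \<open>c\<close> in the full simplex and by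
  \<open>b\<close> in the higher nerve. The cycle \<open>c - b\<close> is filled by \<open>e\<close>
  in the lower nerve, one degree up, and the fibre part of \<open>e\<close> corrects
  \<open>c\<close> to a filling inside the link nerve.\<close>

lemma exact_at_link_nerve:
  fixes A :: "nat \<Rightarrow> 'v set"
  assumes A: "\<And>l. l \<in> {1..r} \<Longrightarrow> finite (A l)" and T: "\<exists>l\<in>{1..r}. T \<subseteq> A l"
    and exN: "exact_at TYPE('k::field) (q + 1) (nerve_complex r A (card T))"
    and exN': "exact_at TYPE('k) q (nerve_complex r A (Suc (card T)))"
  shows "exact_at TYPE('k) q (link_nerve r A T)"
proof (rule exact_atI)
  fix z :: "nat set \<Rightarrow>\<^sub>0 'k" assume z: "z \<in> simplicial_chains q (link_nerve r A T)" "boundary z = 0"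
  let ?S = "{l \<in> {1..r}. T \<subseteq> A l}" and ?N = "nerve_complex r A (card T)"
  let ?P = "chain_part (nerve_fibre r A T) :: (nat set \<Rightarrow>\<^sub>0 'k) \<Rightarrow> _"
  have "z \<in> simplicial_chains q (Pow ?S)"
    using z(1) by (auto simp: simplicial_chains_iff link_nerve_def)
  moreover have "exact_at TYPE('k) q (Pow ?S)" using T by (intro exact_at_Pow) auto
  ultimately obtain c where c: "c \<in> simplicial_chains (q + 1) (Pow ?S)" "boundary c = z"
    using z(2) by (blast elim: exact_atE)
  have "z \<in> simplicial_chains q (nerve_complex r A (Suc (card T)))"
    using z(1) simplicial_chains_mono[OF link_nerve_subset[of r A T, OF A]] by blast
  then obtain b where b: "b \<in> simplicial_chains (q + 1) (nerve_complex r A (Suc (card T)))" "boundary b = z"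
    using exN' z(2) by (blast elim: exact_atE)
  have "c - b \<in> simplicial_chains (q + 1) ?N"
  proof (rule diff_simplicial_chains)
    show "c \<in> simplicial_chains (q + 1) ?N"
      by (rule subsetD[OF simplicial_chains_mono c(1)]) (rule star_subset_nerve_complex[OF A])
    show "b \<in> simplicial_chains (q + 1) ?N"
      by (rule subsetD[OF simplicial_chains_mono[OF nerve_complex_Suc_subset] b(1)])
  qed
  then obtain e where e: "e \<in> simplicial_chains (q + 1 + 1) ?N" "boundary e = c - b"
    using exN c b by (auto simp: boundary.diff elim: exact_atE)
  have Pe: "?P e \<in> simplicial_chains (q + 1 + 1) (Pow ?S)"
    by (rule chain_part_simplicial_chains[OF e(1)]) (use nerve_fibre_subset in blast)
  have S: "simplicial_complex (Pow ?S)" by (intro simplicial_complex_Pow) auto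
  have "c - boundary (?P e) \<in> simplicial_chains (q + 1) (Pow ?S)"
    by (rule diff_simplicial_chains[OF c(1)])
      (use boundary_simplicial_chains[OF S Pe] in \<open>simp add: algebra_simps\<close>)
  moreover have "?P (c - boundary (?P e)) = 0"
  proof -
    \<comment> \<open>Intersections over nonempty faces of \<open>b\<close> have more than
      \<open>card T\<close> elements, so \<open>b\<close> misses the fibre. Thus \<open>c\<close>
      and \<open>boundary e\<close> have equal fibre parts.\<close>
    have "?P b = 0"
      using b(1) by (intro chain_part_eq_0) (auto simp: simplicial_chains_iff nerve_complex_def nerve_fibre_def)
    then show ?thesis
      using chain_part_nerve_fibre_boundary[OF A e(1)] e(2) by (simp add: chain_part.diff)
  qed
  ultimately have "c - boundary (?P e) \<in> simplicial_chains (q + 1) (link_nerve r A T)"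
    using keys_chain_part[of "nerve_fibre r A T" "c - boundary (?P e)"]
    by (auto simp: simplicial_chains_iff link_nerve_def)
  moreover have "boundary (c - boundary (?P e)) = z"
    using c(2) boundary_boundary_chain[OF S Pe] by (simp add: boundary.diff)
  ultimately show "\<exists>b\<in>simplicial_chains (q + 1) (link_nerve r A T). boundary b = z" by blast
qed

lemma chain_part_UN:
  assumes "finite I" "\<And>i j. i \<in> I \<Longrightarrow> j \<in> I \<Longrightarrow> i \<noteq> j \<Longrightarrow> S i \<inter> S j = {}"
  shows "chain_part (\<Union>i\<in>I. S i) c = (\<Sum>i\<in>I. chain_part (S i) c)"
proof (rule poly_mapping_eqI)
  fix F
  show "Poly_Mapping.lookup (chain_part (\<Union>i\<in>I. S i) c) F =
    Poly_Mapping.lookup (\<Sum>i\<in>I. chain_part (S i) c) F"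
  proof (cases "F \<in> (\<Union>i\<in>I. S i)")
    case True
    then obtain i where i: "i \<in> I" "F \<in> S i" by blast
    then have "(\<Sum>j\<in>I. if F \<in> S j then Poly_Mapping.lookup c F else 0) =
      (\<Sum>j\<in>I. if j = i then Poly_Mapping.lookup c F else 0)"
      using assms(2) by (intro sum.cong) auto
    then show ?thesis using i assms(1) by (auto simp: lookup_sum lookup_chain_part)
  qed (auto simp: lookup_sum lookup_chain_part)
qed

text \<open>A filling \<open>c\<close> in the lower nerve is pushed into the higher one: its part in
  the fibre of each \<open>T\<close> is replaced by a chain of the link nerve with the same
  boundary.\<close>

lemma exact_at_nerve_complex_Suc:
  fixes A :: "nat \<Rightarrow> 'v set"
  assumes A: "\<And>l. l \<in> {1..r} \<Longrightarrow> finite (A l)"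
    and exN: "exact_at TYPE('k::field) q (nerve_complex r A j)"
    and ex: "\<And>T. card T = j \<Longrightarrow> \<exists>l\<in>{1..r}. T \<subseteq> A l \<Longrightarrow> exact_at TYPE('k) q (link_nerve r A T)"
  shows "exact_at TYPE('k) q (nerve_complex r A (Suc j))"
proof (rule exact_atI)
  let ?N = "nerve_complex r A j" and ?N' = "nerve_complex r A (Suc j)"
  let ?P = "\<lambda>T. chain_part (nerve_fibre r A T) :: (nat set \<Rightarrow>\<^sub>0 'k) \<Rightarrow> _"
  fix z :: "nat set \<Rightarrow>\<^sub>0 'k" assume z: "z \<in> simplicial_chains q ?N'" "boundary z = 0"
  then have "z \<in> simplicial_chains q ?N" using simplicial_chains_mono[OF nerve_complex_Suc_subset] by blast
  then obtain c where c: "c \<in> simplicial_chains (q + 1) ?N" "boundary c = z"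
    using exN z(2) by (blast elim: exact_atE)
  \<comment> \<open>Containment in some finite \<open>A l\<close> matters for \<open>j = 0\<close>,
    since \<open>card T = 0\<close> also holds for infinite \<open>T\<close>.\<close>
  define \<T> where "\<T> = {T. card T = j \<and> (\<exists>l\<in>{1..r}. T \<subseteq> A l)}"
  have "\<exists>d\<in>simplicial_chains (q + 1) (link_nerve r A T). boundary d = boundary (?P T c)"
    if T: "T \<in> \<T>" for T
  proof -
    let ?S = "{l \<in> {1..r}. T \<subseteq> A l}"
    have S: "simplicial_complex (Pow ?S)" by (intro simplicial_complex_Pow) auto
    have Pc: "?P T c \<in> simplicial_chains (q + 1) (Pow ?S)"
      by (rule chain_part_simplicial_chains[OF c(1)]) (use nerve_fibre_subset in blast)
    \<comment> \<open>The cycle \<open>z\<close> lives in the higher nerve, which is disjoint from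
      the fibre of \<open>T\<close>; so the boundary of the fibre part of \<open>c\<close> has no
      fibre part and lies in the link nerve.\<close>
    have "?P T z = 0"
      using z(1) T by (intro chain_part_eq_0)
        (auto simp: simplicial_chains_iff nerve_complex_def nerve_fibre_def \<T>_def)
    then have "?P T (boundary (?P T c)) = 0"
      using chain_part_nerve_fibre_boundary[OF A, where c = c and T = T and q = "q + 1"] c T
      by (simp add: \<T>_def)
    then have "boundary (?P T c) \<in> simplicial_chains q (link_nerve r A T)"
      using boundary_simplicial_chains[OF S Pc] keys_chain_part[of "nerve_fibre r A T" "boundary (?P T c)"]
      by (auto simp: simplicial_chains_iff link_nerve_def)
    then show ?thesis
      using ex[of T] T boundary_boundary_chain[OF S Pc] by (auto simp: \<T>_def elim: exact_atE)
  qed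
  then obtain d where d: "\<And>T. T \<in> \<T> \<Longrightarrow> d T \<in> simplicial_chains (q + 1) (link_nerve r A T)"
    "\<And>T. T \<in> \<T> \<Longrightarrow> boundary (d T) = boundary (?P T c)" by metis
  have "\<T> \<subseteq> (\<Union>l\<in>{1..r}. Pow (A l))" by (auto simp: \<T>_def)
  then have "finite \<T>" by (rule finite_subset) (use A in auto)
  then have "chain_part (\<Union>T\<in>\<T>. nerve_fibre r A T) c = (\<Sum>T\<in>\<T>. ?P T c)"
    by (rule chain_part_UN) (auto simp: nerve_fibre_def)
  \<comment> \<open>Within \<open>?N\<close> the faces outside \<open>?N'\<close> are exactly those
    in some fibre, and \<open>c\<close> vanishes outside \<open>?N\<close>.\<close>
  moreover have "chain_part (- ?N') c = chain_part (\<Union>T\<in>\<T>. nerve_fibre r A T) c"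
  proof (rule poly_mapping_eqI)
    fix F
    show "Poly_Mapping.lookup (chain_part (- ?N') c) F =
      Poly_Mapping.lookup (chain_part (\<Union>T\<in>\<T>. nerve_fibre r A T) c) F"
    proof (cases "F \<in> ?N")
      case True
      then have "F \<in> - ?N' \<longleftrightarrow> F \<in> (\<Union>T\<in>\<T>. nerve_fibre r A T)"
        by (auto simp: nerve_complex_def nerve_fibre_def \<T>_def)
      then show ?thesis by (simp only: lookup_chain_part)
    next
      case False
      then have "Poly_Mapping.lookup c F = 0" using c(1) by (auto simp: simplicial_chains_iff in_keys_iff)
      then show ?thesis by (simp add: lookup_chain_part)
    qed
  qed
  ultimately have split: "c = chain_part ?N' c + (\<Sum>T\<in>\<T>. ?P T c)"
    by (metis chain_part_split)
  have "boundary (chain_part ?N' c + (\<Sum>T\<in>\<T>. d T)) = boundary (chain_part ?N' c + (\<Sum>T\<in>\<T>. ?P T c))"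
    by (simp add: boundary.add boundary.sum d(2))
  also have "\<dots> = z" using c(2) split by simp
  finally have "boundary (chain_part ?N' c + (\<Sum>T\<in>\<T>. d T)) = z" .
  moreover have "d T \<in> simplicial_chains (q + 1) ?N'" if "T \<in> \<T>" for T
    using d(1)[OF that] that simplicial_chains_mono[OF link_nerve_subset[of r A T, OF A]]
    by (auto simp: \<T>_def)
  then have "chain_part ?N' c + (\<Sum>T\<in>\<T>. d T) \<in> simplicial_chains (q + 1) ?N'"
    by (intro add_simplicial_chains sum_simplicial_chains chain_part_simplicial_chains[OF c(1)]) auto
  ultimately show "\<exists>b\<in>simplicial_chains (q + 1) ?N'. boundary b = z" by blast
qed

text \<open>The link is the union of the full simplices on \<open>A l - T\<close> with
  \<open>T \<subseteq> A l\<close>. These sets have a common point iff the intersection of the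
  \<open>A l\<close> is not just \<open>T\<close>, so the nerve lemma applies.\<close>

lemma exact_at_link_iff:
  fixes A :: "nat \<Rightarrow> 'v::linorder set"
  assumes A: "\<And>l. l \<in> {1..r} \<Longrightarrow> finite (A l)" and \<Delta>: "\<And>F. F \<in> \<Delta> \<longleftrightarrow> (\<exists>l\<in>{1..r}. F \<subseteq> A l)"
    and T: "T \<in> \<Delta>"
  shows "exact_at TYPE('k::field) q (link \<Delta> T) \<longleftrightarrow> exact_at TYPE('k) q (link_nerve r A T)"
proof -
  let ?S = "{l \<in> {1..r}. T \<subseteq> A l}"
  have "link \<Delta> T = {G. \<exists>l\<in>?S. G \<subseteq> A l - T}"
    by (auto simp: link_def \<Delta>)
  moreover have "link_nerve r A T = {F. F \<subseteq> ?S \<and> (F = {} \<or> (\<Inter>l\<in>F. A l - T) \<noteq> {})}"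
  proof -
    have "(\<Inter>l\<in>F. A l) \<noteq> T \<longleftrightarrow> (\<Inter>l\<in>F. A l - T) \<noteq> {}" if "F \<subseteq> ?S" "F \<noteq> {}" for F
    proof -
      have "T \<subseteq> (\<Inter>l\<in>F. A l)" using that by blast
      moreover have "(\<Inter>l\<in>F. A l - T) = (\<Inter>l\<in>F. A l) - T" using that(2) by auto
      ultimately show ?thesis by blast
    qed
    moreover have "link_nerve r A T = {F. F \<subseteq> ?S \<and> (F = {} \<or> (\<Inter>l\<in>F. A l) \<noteq> T)}"
      unfolding link_nerve_def nerve_fibre_def by blast
    ultimately show ?thesis by (simp cong: conj_cong disj_cong)
  qed
  moreover have "exact_at TYPE('k) q {G. \<exists>l\<in>?S. G \<subseteq> A l - T} \<longleftrightarrow>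
    exact_at TYPE('k) q {F. F \<subseteq> ?S \<and> (F = {} \<or> (\<Inter>l\<in>F. A l - T) \<noteq> {})}"
    by (rule nerve_lemma) (use A T \<Delta> in auto)
  ultimately show ?thesis by simp
qed

lemma simplicial_complex_link:
  assumes "simplicial_complex \<Delta>" "T \<in> \<Delta>"
  shows "simplicial_complex (link \<Delta> T)"
  unfolding simplicial_complex_def
proof (intro conjI ballI allI impI)
  show "{} \<in> link \<Delta> T" using assms simplicial_complexD(1)[OF assms(1)] by (simp add: link_def)
  fix F assume F: "F \<in> link \<Delta> T"
  then show "finite F" using simplicial_complexD(2)[OF assms(1)] by (simp add: link_def)
  fix G assume "G \<subseteq> F"
  then show "G \<in> link \<Delta> T"
    using F simplicial_complexD(3)[OF assms(1), of F G] simplicial_complexD(3)[OF assms(1), of "F \<union> T" "G \<union> T"]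
    by (auto simp: link_def)
qed

theorem theorem5p1:
  fixes \<Delta> :: "'v::linorder set set" and A :: "nat \<Rightarrow> 'v set" and r :: nat and m :: int
  assumes "simplicial_complex \<Delta>" and "finite \<Delta>"
    and "bij_betw A {1..r} (facets \<Delta>)"
  shows "(\<forall>i j :: nat. int i + int j < m \<longrightarrow>
            trivial_group (reduced_homology TYPE('k::field) (int i - 1) (nerve_complex r A (j + 1))))
     \<longleftrightarrow>
         (\<forall>i j :: nat. int i + int j < m \<longrightarrow>
            (\<forall>T\<in>\<Delta>. card T = j \<longrightarrow>
               trivial_group (reduced_homology TYPE('k) (int i - 1) (link \<Delta> T))))"
proof -
  have img: "A ` {1..r} = facets \<Delta>" using assms(3) by (simp add: bij_betw_def)
  then have A\<Delta>: "A l \<in> \<Delta>" if "l \<in> {1..r}" for l using that by (auto simp: facets_def)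
  then have A: "finite (A l)" if "l \<in> {1..r}" for l
    using that simplicial_complexD(2)[OF assms(1)] by blast
  have \<Delta>: "F \<in> \<Delta> \<longleftrightarrow> (\<exists>l\<in>{1..r}. F \<subseteq> A l)" for F
  proof
    assume "F \<in> \<Delta>"
    then obtain G where "G \<in> \<Delta>" "F \<subseteq> G" "\<forall>H\<in>\<Delta>. G \<subseteq> H \<longrightarrow> H = G"
      using finite_has_maximal2[OF assms(2)] by metis
    then have "G \<in> A ` {1..r}" unfolding img by (simp add: facets_def)
    then show "\<exists>l\<in>{1..r}. F \<subseteq> A l" using \<open>F \<subseteq> G\<close> by blast
  next
    assume "\<exists>l\<in>{1..r}. F \<subseteq> A l"
    then show "F \<in> \<Delta>" using A\<Delta> simplicial_complexD(3)[OF assms(1)] by blast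
  qed
  \<comment> \<open>The empty face lies in some \<open>A l\<close>, so the index set is nonempty and
    the full simplex is acyclic.\<close>
  have N0: "exact_at TYPE('k) q (nerve_complex r A 0)" for q
    unfolding nerve_complex_0 using \<Delta>[of "{}"] simplicial_complexD(1)[OF assms(1)]
    by (intro exact_at_Pow) auto
  have link: "exact_at TYPE('k) q (link \<Delta> T) \<longleftrightarrow> exact_at TYPE('k) q (link_nerve r A T)"
    if "T \<in> \<Delta>" for T q
    by (rule exact_at_link_iff[OF A \<Delta> that])
  have "(\<forall>i j :: nat. int i + int j < m \<longrightarrow> exact_at TYPE('k) (int i - 1) (nerve_complex r A (Suc j)))
    \<longleftrightarrow> (\<forall>i j :: nat. int i + int j < m \<longrightarrow>
      (\<forall>T\<in>\<Delta>. card T = j \<longrightarrow> exact_at TYPE('k) (int i - 1) (link \<Delta> T)))"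
  proof (intro iffI allI impI ballI)
    fix i j :: nat and T
    assume N: "\<forall>i j :: nat. int i + int j < m \<longrightarrow>
      exact_at TYPE('k) (int i - 1) (nerve_complex r A (Suc j))"
      and ij: "int i + int j < m" and T: "T \<in> \<Delta>" "card T = j"
    \<comment> \<open>Raising the degree and lowering the level by one keeps the sum
      \<open>i + j\<close>, so the hypothesis applies at \<open>Suc i\<close> and \<open>j'\<close>;
      level \<open>0\<close> is the full simplex.\<close>
    have "exact_at TYPE('k) (int i) (nerve_complex r A j)"
    proof (cases j)
      case (Suc j')
      then show ?thesis using N[rule_format, of "Suc i" j'] ij by simp
    qed (simp add: N0)
    then show "exact_at TYPE('k) (int i - 1) (link \<Delta> T)"
      unfolding link[OF T(1)]
      using N[rule_format, OF ij] T \<Delta>[of T] by (intro exact_at_link_nerve A) auto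
  next
    fix i j :: nat
    assume L: "\<forall>i j :: nat. int i + int j < m \<longrightarrow>
      (\<forall>T\<in>\<Delta>. card T = j \<longrightarrow> exact_at TYPE('k) (int i - 1) (link \<Delta> T))"
    show "exact_at TYPE('k) (int i - 1) (nerve_complex r A (Suc j))" if "int i + int j < m"
      using that
    \<comment> \<open>The degree stays fixed while the level climbs from the full simplex; the bound
      on \<open>i + j\<close> passes to all lower levels.\<close>
    proof (induction j)
      case 0
      show ?case
        by (rule exact_at_nerve_complex_Suc[OF A N0]) (use 0 L link \<Delta> in blast)+
    next
      case (Suc j)
      have "exact_at TYPE('k) (int i - 1) (nerve_complex r A (Suc j))"
        by (rule Suc.IH) (use Suc.prems in simp)
      from A this show ?case
        by (rule exact_at_nerve_complex_Suc) (use Suc.prems L link \<Delta> in blast)+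
    qed
  qed
  then show ?thesis
    using simplicial_complex_link[OF assms(1)] simplicial_complex_nerve_complex[OF A, of r]
    by (simp add: trivial_reduced_homology_iff)
qed

end
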